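(* Let $\mathcal{A}$ be the disk algebra, let $\varphi\in S(\mathbb{D})$, and let $X$ be either $H^\infty(\mathbb{D})$ or $\mathcal{B}$. Then $C_\varphi I_g-I_gC_\varphi:X\to\mathcal{B}$ is compact for all $g\in\mathcal{A}$ if and only if $$\lim_{|\varphi(z)|\to1}|\varphi^\#(z)|\,|\varphi(z)-z|=0.$$
   Context: $\mathbb{D}$ is the open unit disk in $\mathbb{C}$, $H(\mathbb{D})$ is the set of holomorphic functions on $\mathbb{D}$, $H^\infty(\mathbb{D})$ the bounded ones with the supremum norm, and $S(\mathbb{D})$ is the set of holomorphic maps $\mathbb{D}\to\mathbb{D}$. The disk algebra $\mathcal{A}$ is the subspace of $H^\infty(\mathbb{D})$ of functions analytic in $\mathbb{D}$ and continuous up to the unit circle. For $\varphi\in S(\mathbb{D})$, $C_\varphi f=f\circ\varphi$ and $\varphi^\#(z)=\frac{1-|z|^2}{1-|\varphi(z)|^2}\varphi'(z)$. For $g,f\in H(\mathbb{D})$, $I_gf(z)=\int_0^z f'(\zeta)g(\zeta)\,d\zeta$. The Bloch space $\mathcal{B}$ is the set of $f\in H(\mathbb{D})$ with $\|f\|_*=\sup_{z\in\mathbb{D}}(1-|z|^2)|f'(z)|<\infty$, a Banach space with norm $|f(0)|+\|f\|_*$. The notation $\lim_{|\varphi(z)|\to1}F(z)=0$ means: for every $\varepsilon>0$ there is $r\in(0,1)$ such that $|F(z)|<\varepsilon$ whenever $z\in\mathbb{D}$ and $|\varphi(z)|>r$ (vacuously true if $\sup_{\mathbb{D}}|\varphi|<1$).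 *)

theory Defs
  imports "HOL-Complex_Analysis.Complex_Analysis"
begin

abbreviation disk :: "complex set" where
  "disk \<equiv> ball 0 1"

text \<open>HOL functions are total, so a function on the disk is represented by the function on
  \<open>complex\<close> that extends it by \<open>0\<close>. The representation is unique, and the function spaces below
  are closed under pointwise linear operations.\<close>

definition on_disk :: "(complex \<Rightarrow> complex) \<Rightarrow> complex \<Rightarrow> complex" where
  "on_disk f = (\<lambda>z. if z \<in> disk then f z else 0)"

definition hol_disk :: "(complex \<Rightarrow> complex) set" where
  "hol_disk = {f. f holomorphic_on disk \<and> (\<forall>z. z \<notin> disk \<longrightarrow> f z = 0)}"

definition hinf :: "(complex \<Rightarrow> complex) set" where
  "hinf = {f \<in> hol_disk. bounded (f ` disk)}"

definition hinf_norm :: "(complex \<Rightarrow> complex) \<Rightarrow> real" where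
  "hinf_norm f = (SUP z\<in>disk. norm (f z))"

definition bloch :: "(complex \<Rightarrow> complex) set" where
  "bloch = {f \<in> hol_disk. bdd_above ((\<lambda>z. (1 - (norm z)\<^sup>2) * norm (deriv f z)) ` disk)}"

definition bloch_seminorm :: "(complex \<Rightarrow> complex) \<Rightarrow> real" where
  "bloch_seminorm f = (SUP z\<in>disk. (1 - (norm z)\<^sup>2) * norm (deriv f z))"

definition bloch_norm :: "(complex \<Rightarrow> complex) \<Rightarrow> real" where
  "bloch_norm f = norm (f 0) + bloch_seminorm f"

text \<open>Elements are functions on the open disk; continuity up to the unit circle
  means having a continuous extension to the closed disk.\<close>

definition disk_algebra :: "(complex \<Rightarrow> complex) set" where
  "disk_algebra = {g \<in> hinf. \<exists>G. continuous_on (cball 0 1) G \<and> (\<forall>z\<in>disk. G z = g z)}"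

text \<open>The values of a self-map outside the disk are never used, so they are left arbitrary.\<close>

definition self_maps :: "(complex \<Rightarrow> complex) set" where
  "self_maps = {\<phi>. \<phi> holomorphic_on disk \<and> \<phi> ` disk \<subseteq> disk}"

definition comp_op :: "(complex \<Rightarrow> complex) \<Rightarrow> (complex \<Rightarrow> complex) \<Rightarrow> complex \<Rightarrow> complex" where
  "comp_op \<phi> f = on_disk (f \<circ> \<phi>)"

definition int_op :: "(complex \<Rightarrow> complex) \<Rightarrow> (complex \<Rightarrow> complex) \<Rightarrow> complex \<Rightarrow> complex" where
  "int_op g f = on_disk (\<lambda>z. contour_integral (linepath 0 z) (\<lambda>\<zeta>. deriv f \<zeta> * g \<zeta>))"

definition hyp_deriv :: "(complex \<Rightarrow> complex) \<Rightarrow> complex \<Rightarrow> complex" where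
  "hyp_deriv \<phi> z = of_real ((1 - (norm z)\<^sup>2) / (1 - (norm (\<phi> z))\<^sup>2)) * deriv \<phi> z"

text \<open>The locale \<open>Metric_space\<close> demands nonnegativity and symmetry of the distance on the whole type;
  the value \<open>0\<close> off the carrier only serves this purpose and does not affect the topology.\<close>

definition norm_dist ::
  "(complex \<Rightarrow> complex) set \<Rightarrow> ((complex \<Rightarrow> complex) \<Rightarrow> real) \<Rightarrow>
   (complex \<Rightarrow> complex) \<Rightarrow> (complex \<Rightarrow> complex) \<Rightarrow> real" where
  "norm_dist Y nY f g = (if f \<in> Y \<and> g \<in> Y then nY (\<lambda>z. f z - g z) else 0)"

definition norm_topology ::
  "(complex \<Rightarrow> complex) set \<Rightarrow> ((complex \<Rightarrow> complex) \<Rightarrow> real) \<Rightarrow> (complex \<Rightarrow> complex) topology" where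
  "norm_topology Y nY = Metric_space.mtopology Y (norm_dist Y nY)"

text \<open>Compactness of a linear operator from \<open>(X, nX)\<close> to \<open>(Y, nY)\<close>: the image of the closed unit
  ball is relatively compact in the norm topology of \<open>Y\<close>. Since the spaces are carrier sets rather
  than types, that \<open>T\<close> is well defined into \<open>Y\<close> and linear on \<open>X\<close> is part of the definition.\<close>

definition compact_operator ::
  "(complex \<Rightarrow> complex) set \<Rightarrow> ((complex \<Rightarrow> complex) \<Rightarrow> real) \<Rightarrow>
   (complex \<Rightarrow> complex) set \<Rightarrow> ((complex \<Rightarrow> complex) \<Rightarrow> real) \<Rightarrow>
   ((complex \<Rightarrow> complex) \<Rightarrow> complex \<Rightarrow> complex) \<Rightarrow> bool" where
  "compact_operator X nX Y nY T \<longleftrightarrow>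
     T \<in> X \<rightarrow> Y \<and>
     (\<forall>f\<in>X. \<forall>h\<in>X. T (\<lambda>z. f z + h z) = (\<lambda>z. T f z + T h z)) \<and>
     (\<forall>c. \<forall>f\<in>X. T (\<lambda>z. c * f z) = (\<lambda>z. c * T f z)) \<and>
     compactin (norm_topology Y nY) (norm_topology Y nY closure_of (T ` {f \<in> X. nX f \<le> 1}))"

definition vanishes_when_near_circle :: "(complex \<Rightarrow> complex) \<Rightarrow> (complex \<Rightarrow> real) \<Rightarrow> bool" where
  "vanishes_when_near_circle \<phi> F \<longleftrightarrow>
     (\<forall>\<epsilon>>0. \<exists>r\<in>{0<..<1}. \<forall>z\<in>disk. norm (\<phi> z) > r \<longrightarrow> \<bar>F z\<bar> < \<epsilon>)"

text \<open>The topology used on the Bloch space does come from a metric.\<close>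

lemma Metric_space_bloch: "Metric_space bloch (norm_dist bloch bloch_norm)"
proof -
  define w :: "complex \<Rightarrow> real" where "w z = 1 - (norm z)\<^sup>2" for z
  have w_pos: "w z > 0" if "z \<in> disk" for z
    using that by (simp add: w_def power_less_one_iff abs_square_less_1)
  have deriv_minus: "deriv (\<lambda>z. f z - g z) z = deriv f z - deriv g z"
    if "f \<in> bloch" "g \<in> bloch" "z \<in> disk" for f g z
    using that by (intro deriv_diff holomorphic_on_imp_differentiable_at[of _ disk])
      (auto simp: bloch_def hol_disk_def)
  have bdd: "bdd_above ((\<lambda>z. w z * norm (deriv (\<lambda>z. f z - g z) z)) ` disk)"
    if f: "f \<in> bloch" and g: "g \<in> bloch" for f g
  proof -
    obtain A B where A: "\<And>z. z \<in> disk \<Longrightarrow> w z * norm (deriv f z) \<le> A"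
      and B: "\<And>z. z \<in> disk \<Longrightarrow> w z * norm (deriv g z) \<le> B"
      using f g unfolding bloch_def bdd_above_def w_def by blast
    have "w z * norm (deriv (\<lambda>z. f z - g z) z) \<le> A + B" if z: "z \<in> disk" for z
    proof -
      have "w z * norm (deriv (\<lambda>z. f z - g z) z) \<le> w z * (norm (deriv f z) + norm (deriv g z))"
        unfolding deriv_minus[OF f g z] using w_pos[OF z]
        by (intro mult_left_mono norm_triangle_ineq4) auto
      then show ?thesis using A[OF z] B[OF z] by (simp add: distrib_left)
    qed
    then show ?thesis by (intro bdd_aboveI2)
  qed
  have le: "w z * norm (deriv (\<lambda>z. f z - g z) z) \<le> bloch_seminorm (\<lambda>z. f z - g z)"
    if "f \<in> bloch" "g \<in> bloch" "z \<in> disk" for f g z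
    unfolding bloch_seminorm_def w_def[symmetric] using that by (intro cSUP_upper bdd)
  have zero_in: "(0::complex) \<in> disk"
    by simp
  have semi_nonneg: "0 \<le> bloch_seminorm (\<lambda>z. f z - g z)" if "f \<in> bloch" "g \<in> bloch" for f g
    using le[OF that zero_in] by (rule order_trans[rotated]) (simp add: w_def)
  have commute: "bloch_norm (\<lambda>z. f z - g z) = bloch_norm (\<lambda>z. g z - f z)"
    if f: "f \<in> bloch" and g: "g \<in> bloch" for f g
    unfolding bloch_norm_def bloch_seminorm_def
    by (intro arg_cong2[where f = "(+)"] SUP_cong refl)
      (simp_all add: deriv_minus[OF f g] deriv_minus[OF g f] norm_minus_commute)
  have eq: "f = g"
    if f: "f \<in> bloch" and g: "g \<in> bloch" and 0: "bloch_norm (\<lambda>z. f z - g z) = 0" for f g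
  proof -
    have eq0: "f 0 = g 0" and semi0: "bloch_seminorm (\<lambda>z. f z - g z) = 0"
      using 0 semi_nonneg[OF f g] by (simp_all add: bloch_norm_def add_nonneg_eq_0_iff)
    have hol: "(\<lambda>z. f z - g z) holomorphic_on disk"
      using f g by (auto simp: bloch_def hol_disk_def intro: holomorphic_intros)
    have der0: "deriv (\<lambda>z. f z - g z) z = 0" if z: "z \<in> disk" for z
    proof -
      have "w z * norm (deriv (\<lambda>z. f z - g z) z) \<le> 0"
        using le[OF f g z] semi0 by simp
      then show ?thesis using w_pos[OF z] by (simp add: mult_le_0_iff)
    qed
    have "((\<lambda>z. f z - g z) has_field_derivative 0) (at z within disk)" if "z \<in> disk" for z
      using holomorphic_derivI[OF hol open_ball that] der0[OF that]
      by (simp add: has_field_derivative_at_within)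
    then obtain c where "\<forall>z\<in>disk. f z - g z = c"
      using has_field_derivative_zero_constant[of disk "\<lambda>z. f z - g z"] by auto
    then have "f z = g z" if "z \<in> disk" for z
      using that zero_in eq0 by (metis eq_iff_diff_eq_0)
    then show "f = g"
      using f g by (intro ext) (metis (mono_tags, lifting) bloch_def hol_disk_def mem_Collect_eq)
  qed
  have triangle: "bloch_norm (\<lambda>z. f z - h z) \<le> bloch_norm (\<lambda>z. f z - g z) + bloch_norm (\<lambda>z. g z - h z)"
    if f: "f \<in> bloch" and g: "g \<in> bloch" and h: "h \<in> bloch" for f g h
  proof -
    have "bloch_seminorm (\<lambda>z. f z - h z) \<le> bloch_seminorm (\<lambda>z. f z - g z) + bloch_seminorm (\<lambda>z. g z - h z)"
      unfolding bloch_seminorm_def[of "\<lambda>z. f z - h z"]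
    proof (rule cSUP_least)
      fix z :: complex assume z: "z \<in> disk"
      have "norm (deriv f z - deriv h z) \<le> norm (deriv f z - deriv g z) + norm (deriv g z - deriv h z)"
        using norm_triangle_ineq[of "deriv f z - deriv g z" "deriv g z - deriv h z"] by simp
      then have "w z * norm (deriv (\<lambda>z. f z - h z) z) \<le>
          w z * (norm (deriv (\<lambda>z. f z - g z) z) + norm (deriv (\<lambda>z. g z - h z) z))"
        using w_pos[OF z]
        by (simp add: deriv_minus[OF f g z] deriv_minus[OF f h z] deriv_minus[OF g h z])
      also have "\<dots> \<le> bloch_seminorm (\<lambda>z. f z - g z) + bloch_seminorm (\<lambda>z. g z - h z)"
        using le[OF f g z] le[OF g h z] by (simp add: distrib_left)
      finally show "(1 - (norm z)\<^sup>2) * norm (deriv (\<lambda>z. f z - h z) z) \<le> \<dots>"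
        by (simp add: w_def)
    qed auto
    moreover have "norm (f 0 - h 0) \<le> norm (f 0 - g 0) + norm (g 0 - h 0)"
      using norm_triangle_ineq[of "f 0 - g 0" "g 0 - h 0"] by simp
    ultimately show ?thesis by (simp add: bloch_norm_def)
  qed
  have refl: "bloch_norm (\<lambda>z. f z - f z) = 0" for f
    by (simp add: bloch_norm_def bloch_seminorm_def)
  show ?thesis
  proof
    show "0 \<le> norm_dist bloch bloch_norm f g" for f g
      using semi_nonneg by (simp add: norm_dist_def bloch_norm_def)
    show "norm_dist bloch bloch_norm f g = norm_dist bloch bloch_norm g f" for f g
      unfolding norm_dist_def using commute[of f g] by metis
    show "norm_dist bloch bloch_norm f g = 0 \<longleftrightarrow> f = g" if "f \<in> bloch" "g \<in> bloch" for f g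
      using that eq refl by (auto simp: norm_dist_def simp del: right_minus_eq)
    show "norm_dist bloch bloch_norm f h \<le> norm_dist bloch bloch_norm f g + norm_dist bloch bloch_norm g h"
      if "f \<in> bloch" "g \<in> bloch" "h \<in> bloch" for f g h
      using that triangle by (simp add: norm_dist_def)
  qed
qed

end

theory Submission
  imports Defs
begin

text \<open>
  Write \<open>T = C\<^sub>\<phi> I\<^sub>g - I\<^sub>g C\<^sub>\<phi>\<close>. Differentiating removes the integrals:
  \<open>(T f)' = (f' \<circ> \<phi>) \<phi>' (g \<circ> \<phi> - g)\<close>, so the weighted derivative that enters the Bloch
  seminorm of \<open>T f\<close> is, in modulus, the product of
  \<open>(1 - |\<phi>(z)|\<^sup>2) |f'(\<phi>(z))|\<close> and \<open>L\<^sub>g(z) = |\<phi>\<^sup>#(z)| |g(\<phi>(z)) - g(z)|\<close>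
  (\<open>weighted_deriv_commutator\<close>). The first factor is at most the Bloch seminorm of \<open>f\<close>, and
  \<open>|\<phi>\<^sup>#| \<le> 1\<close> by the Schwarz-Pick lemma.

  If \<open>L\<^sub>g(z)\<close> tends to \<open>0\<close> as \<open>|\<phi>(z)| \<rightarrow> 1\<close>, then \<open>T\<close> is compact: a sequence in the unit ball
  has a subsequence that converges locally uniformly (Montel) to an element of the ball. For
  the differences \<open>h\<^sub>n\<close> from the limit, the product is small where \<open>|\<phi>(z)|\<close> is close to \<open>1\<close>
  because \<open>L\<^sub>g\<close> is small there, and elsewhere because \<open>h\<^sub>n' \<rightarrow> 0\<close> uniformly on compact sets
  (\<open>commutator_norm_tendsto_0\<close>, \<open>compact_commutator\<close>). The condition of the theorem is the one
  for the identity function, \<open>g(z) = z\<close>. It implies the condition for every \<open>g\<close> in the disk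
  algebra, since \<open>g\<close> is uniformly continuous: either \<open>\<phi>(z)\<close> and \<open>z\<close> are close, and then so are
  their images under \<open>g\<close>, or \<open>|\<phi>\<^sup>#(z)|\<close> itself is small (\<open>vanishes_for_disk_algebra\<close>).

  Conversely, compactness for \<open>g(z) = z\<close> alone forces the condition. If it fails along
  \<open>z\<^sub>n\<close> with \<open>w\<^sub>n = \<phi>(z\<^sub>n)\<close>, the functions \<open>(1 - |w\<^sub>n|\<^sup>2) / (1 - cnj w\<^sub>n z)\<close> are bounded
  in the supremum norm and their derivatives tend to \<open>0\<close> pointwise, while the weighted derivative
  at \<open>w\<^sub>n\<close> stays away from \<open>0\<close>; so their images under \<open>T\<close> have no subsequence that converges in
  the Bloch norm (\<open>vanishes_of_compact_commutator_id\<close>).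

  The argument uses of \<open>X\<close> only that its unit ball is bounded in the Bloch norm, contains a ball of
  bounded functions and is closed under locally uniform limits. The locale
  \<open>disk_function_space\<close> collects these properties, and both spaces satisfy them.
\<close>

section \<open>Holomorphic self-maps and derivative estimates\<close>

lemma one_minus_norm_sq_pos: "norm z < 1 \<Longrightarrow> 0 < 1 - (norm (z::complex))\<^sup>2"
  by (simp add: abs_square_less_1)

text \<open>Moving \<open>z\<close> and \<open>\<phi> z\<close> to the origin by disk automorphisms turns \<open>\<phi>\<close> into a self-map
  that fixes \<open>0\<close>, and the derivative of that map at \<open>0\<close> is the hyperbolic derivative of
  \<open>\<phi>\<close> at \<open>z\<close>; the Schwarz lemma bounds it by \<open>1\<close>.\<close>

lemma Schwarz_Pick:
  assumes \<phi>: "\<phi> \<in> self_maps" and z: "norm z < 1"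
  shows "(1 - (norm z)\<^sup>2) * norm (deriv \<phi> z) \<le> 1 - (norm (\<phi> z))\<^sup>2"
proof -
  have hol: "\<phi> holomorphic_on disk" and maps: "\<And>u. norm u < 1 \<Longrightarrow> norm (\<phi> u) < 1"
    using \<phi> by (auto simp: self_maps_def image_subset_iff)
  define M where "M = Moebius_function 0 (- z)"
  define N where "N = Moebius_function 0 (\<phi> z)"
  have M_hol: "M holomorphic_on disk" and N_hol: "N holomorphic_on disk"
    unfolding M_def N_def using z maps[OF z] by (auto intro!: Moebius_function_holomorphic)
  have M_maps: "norm (M u) < 1" if "norm u < 1" for u
    unfolding M_def using Moebius_function_norm_lt_1[of "- z" u 0] z that by simp
  have N_maps: "norm (N u) < 1" if "norm u < 1" for u
    unfolding N_def using Moebius_function_norm_lt_1[of "\<phi> z" u 0] maps[OF z] that by simp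
  have M0: "M 0 = z"
    by (simp add: M_def Moebius_function_of_zero)
  have sq: "cnj a * a = of_real ((norm a)\<^sup>2)" for a
    by (metis complex_norm_square mult.commute)
  have "(M has_field_derivative 1 - cnj z * z) (at 0)"
    unfolding M_def Moebius_function_simple[abs_def]
    by (rule derivative_eq_intros refl | simp)+
  then have dM: "(M has_field_derivative of_real (1 - (norm z)\<^sup>2)) (at 0)"
    by (simp only: sq of_real_diff of_real_1)
  have nz: "1 - cnj (\<phi> z) * \<phi> z \<noteq> 0"
    using one_minus_norm_sq_pos[OF maps[OF z]] unfolding sq
    by (metis less_irrefl of_real_1 of_real_diff of_real_eq_0_iff)
  have "(N has_field_derivative 1 / (1 - cnj (\<phi> z) * \<phi> z)) (at (\<phi> z))"
    unfolding N_def Moebius_function_simple[abs_def]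
    by (rule derivative_eq_intros refl | use nz in simp)+
  then have dN: "(N has_field_derivative 1 / of_real (1 - (norm (\<phi> z))\<^sup>2)) (at (\<phi> z))"
    by (simp only: sq of_real_diff of_real_1)
  have d\<phi>: "(\<phi> has_field_derivative deriv \<phi> z) (at (M 0))"
    using holomorphic_derivI[OF hol open_ball] z M0 by simp
  have "((N \<circ> (\<phi> \<circ> M)) has_field_derivative
          (1 / of_real (1 - (norm (\<phi> z))\<^sup>2)) * (deriv \<phi> z * of_real (1 - (norm z)\<^sup>2))) (at 0)"
    using dN M0 by (intro DERIV_chain d\<phi> dM) simp_all
  moreover have "norm (deriv (N \<circ> (\<phi> \<circ> M)) 0) \<le> 1"
  proof (rule Schwarz_Lemma(2))
    show "N \<circ> (\<phi> \<circ> M) holomorphic_on disk"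
      by (rule holomorphic_on_compose_gen[OF holomorphic_on_compose_gen[OF M_hol hol] N_hol])
        (use M_maps maps in auto)
    show "(N \<circ> (\<phi> \<circ> M)) 0 = 0"
      using M0 by (simp add: N_def Moebius_function_eq_zero)
    show "norm ((N \<circ> (\<phi> \<circ> M)) u) < 1" if "norm u < 1" for u
      using that M_maps maps N_maps by simp
    show "norm (0::complex) < 1"
      by simp
  qed
  ultimately have "norm ((1 / complex_of_real (1 - (norm (\<phi> z))\<^sup>2)) *
      (deriv \<phi> z * complex_of_real (1 - (norm z)\<^sup>2))) \<le> 1"
    by (simp only: DERIV_imp_deriv)
  then show ?thesis
    using one_minus_norm_sq_pos[OF z] one_minus_norm_sq_pos[OF maps[OF z]]
    by (simp only: norm_mult norm_divide norm_of_real norm_one abs_of_pos)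
      (simp add: field_simps)
qed

lemma hyp_deriv_le_1:
  assumes "\<phi> \<in> self_maps" "norm z < 1"
  shows "norm (hyp_deriv \<phi> z) \<le> 1"
proof -
  have "norm (\<phi> z) < 1"
    using assms by (auto simp: self_maps_def image_subset_iff)
  then have "norm (hyp_deriv \<phi> z) = (1 - (norm z)\<^sup>2) * norm (deriv \<phi> z) / (1 - (norm (\<phi> z))\<^sup>2)"
    using one_minus_norm_sq_pos[of z] one_minus_norm_sq_pos[of "\<phi> z"] assms(2)
    unfolding hyp_deriv_def norm_mult norm_of_real by simp
  then show ?thesis
    using Schwarz_Pick[OF assms] one_minus_norm_sq_pos[of "\<phi> z"] \<open>norm (\<phi> z) < 1\<close> by simp
qed

text \<open>Cauchy's estimate on the disk of radius \<open>s\<close> around \<open>z\<close>. The bound on \<open>f\<close> is asked for on a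
  disk around the origin, which serves all \<open>z\<close> of smaller modulus at once.\<close>

lemma norm_deriv_le_of_bound_on_cball:
  assumes "f holomorphic_on disk" "0 < s" "norm z + s < 1"
    and "\<And>u. norm u \<le> norm z + s \<Longrightarrow> norm (f u) \<le> B"
  shows "norm (deriv f z) \<le> B / s"
proof -
  have sub: "cball z s \<subseteq> disk"
    using assms(3) by (auto simp: dist_norm) (smt (verit) norm_triangle_ineq2 norm_minus_commute)
  have "norm ((deriv ^^ 1) f z) \<le> fact 1 * B / s ^ 1"
  proof (rule Cauchy_inequality)
    show "f holomorphic_on ball z s"
      using assms(1) sub by (meson ball_subset_cball holomorphic_on_subset)
    show "continuous_on (cball z s) f"
      using assms(1) sub by (meson holomorphic_on_imp_continuous_on continuous_on_subset)
    show "norm (f u) \<le> B" if "norm (z - u) = s" for u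
      using that assms(4)[of u] by (smt (verit) norm_triangle_ineq2 norm_minus_commute)
  qed fact
  then show ?thesis by simp
qed

section \<open>The spaces of functions\<close>

lemma hol_diskD:
  assumes "f \<in> hol_disk"
  shows "f holomorphic_on disk" "\<And>z. norm z < 1 \<Longrightarrow> (f has_field_derivative deriv f z) (at z)"
  using assms holomorphic_derivI[of f disk] by (auto simp: hol_disk_def)

lemma hol_disk_on_disk: "f holomorphic_on disk \<Longrightarrow> on_disk f \<in> hol_disk"
  unfolding hol_disk_def on_disk_def by (auto elim: holomorphic_transform)

lemma deriv_on_disk: "norm z < 1 \<Longrightarrow> deriv (on_disk f) z = deriv f z"
  by (rule deriv_cong_ev)
    (auto simp: on_disk_def eventually_nhds intro!: exI[of _ disk])

lemma hol_disk_add: "f \<in> hol_disk \<Longrightarrow> h \<in> hol_disk \<Longrightarrow> (\<lambda>z. f z + h z) \<in> hol_disk"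
  and hol_disk_diff: "f \<in> hol_disk \<Longrightarrow> h \<in> hol_disk \<Longrightarrow> (\<lambda>z. f z - h z) \<in> hol_disk"
  and hol_disk_scale: "f \<in> hol_disk \<Longrightarrow> (\<lambda>z. c * f z) \<in> hol_disk"
  by (auto simp: hol_disk_def intro!: holomorphic_intros)

lemma deriv_hol_disk_add:
  "f \<in> hol_disk \<Longrightarrow> h \<in> hol_disk \<Longrightarrow> norm z < 1 \<Longrightarrow> deriv (\<lambda>z. f z + h z) z = deriv f z + deriv h z"
  and deriv_hol_disk_diff:
  "f \<in> hol_disk \<Longrightarrow> h \<in> hol_disk \<Longrightarrow> norm z < 1 \<Longrightarrow> deriv (\<lambda>z. f z - h z) z = deriv f z - deriv h z"
  and deriv_hol_disk_scale:
  "f \<in> hol_disk \<Longrightarrow> norm z < 1 \<Longrightarrow> deriv (\<lambda>z. c * f z) z = c * deriv f z"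
  by (auto intro!: DERIV_imp_deriv derivative_eq_intros dest: hol_diskD(2))

lemma blochI:
  assumes "f \<in> hol_disk" "\<And>z. norm z < 1 \<Longrightarrow> (1 - (norm z)\<^sup>2) * norm (deriv f z) \<le> B"
  shows "f \<in> bloch" "bloch_seminorm f \<le> B"
  using assms unfolding bloch_def bloch_seminorm_def
  by (auto intro!: bdd_aboveI2[where M = B] cSUP_least)

lemma bloch_seminorm_ge:
  assumes "f \<in> bloch" "norm z < 1"
  shows "(1 - (norm z)\<^sup>2) * norm (deriv f z) \<le> bloch_seminorm f"
  unfolding bloch_seminorm_def by (rule cSUP_upper) (use assms in \<open>auto simp: bloch_def\<close>)

lemma bloch_imp_hol_disk: "f \<in> bloch \<Longrightarrow> f \<in> hol_disk"
  by (simp add: bloch_def)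

lemma bloch_seminorm_nonneg: "f \<in> bloch \<Longrightarrow> 0 \<le> bloch_seminorm f"
  using bloch_seminorm_ge[of f 0] by (simp add: order_trans[OF norm_ge_zero])

lemma bloch_norm_ge:
  assumes "f \<in> bloch"
  shows "norm (f 0) \<le> bloch_norm f" "bloch_seminorm f \<le> bloch_norm f"
    "norm z < 1 \<Longrightarrow> (1 - (norm z)\<^sup>2) * norm (deriv f z) \<le> bloch_norm f"
  using bloch_seminorm_nonneg[OF assms] bloch_seminorm_ge[OF assms, of z]
  by (auto simp: bloch_norm_def intro: order_trans)

lemma bloch_add:
  assumes "f \<in> bloch" "h \<in> bloch"
  shows "(\<lambda>z. f z + h z) \<in> bloch"
proof (rule blochI(1))
  fix z :: complex assume z: "norm z < 1"
  have "(1 - (norm z)\<^sup>2) * norm (deriv f z + deriv h z)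
      \<le> (1 - (norm z)\<^sup>2) * (norm (deriv f z) + norm (deriv h z))"
    using one_minus_norm_sq_pos[OF z] by (intro mult_left_mono norm_triangle_ineq) auto
  also have "\<dots> \<le> bloch_seminorm f + bloch_seminorm h"
    using bloch_seminorm_ge[OF assms(1) z] bloch_seminorm_ge[OF assms(2) z]
    by (simp add: distrib_left)
  finally show "(1 - (norm z)\<^sup>2) * norm (deriv (\<lambda>z. f z + h z) z) \<le> bloch_seminorm f + bloch_seminorm h"
    using assms z by (simp add: deriv_hol_disk_add bloch_imp_hol_disk)
qed (use assms in \<open>auto intro: hol_disk_add bloch_imp_hol_disk\<close>)

lemma bloch_scale:
  assumes "f \<in> bloch"
  shows "(\<lambda>z. c * f z) \<in> bloch"
proof (rule blochI(1))
  fix z :: complex assume z: "norm z < 1"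
  have "norm c * ((1 - (norm z)\<^sup>2) * norm (deriv f z)) \<le> norm c * bloch_seminorm f"
    using bloch_seminorm_ge[OF assms z] by (intro mult_left_mono) auto
  then show "(1 - (norm z)\<^sup>2) * norm (deriv (\<lambda>z. c * f z) z) \<le> norm c * bloch_seminorm f"
    using assms z by (simp add: deriv_hol_disk_scale bloch_imp_hol_disk norm_mult mult_ac)
qed (use assms in \<open>auto intro: hol_disk_scale bloch_imp_hol_disk\<close>)

lemma bloch_diff: "f \<in> bloch \<Longrightarrow> h \<in> bloch \<Longrightarrow> (\<lambda>z. f z - h z) \<in> bloch"
  using bloch_add[of f "\<lambda>z. (-1) * h z"] bloch_scale[of h "-1"] by simp

lemma bloch_norm_diff_ge:
  assumes "f \<in> bloch" "h \<in> bloch" "norm z < 1"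
  shows "(1 - (norm z)\<^sup>2) * norm (deriv f z - deriv h z) \<le> bloch_norm (\<lambda>z. f z - h z)"
  using bloch_norm_ge(3)[OF bloch_diff[OF assms(1,2)] assms(3)] assms
  by (simp add: deriv_hol_disk_diff bloch_imp_hol_disk)

lemma bloch_norm_diff_le:
  assumes f: "f \<in> bloch" and h: "h \<in> bloch"
  shows "bloch_norm (\<lambda>z. f z - h z) \<le> bloch_norm f + bloch_norm h"
proof -
  have "bloch_seminorm (\<lambda>z. f z - h z) \<le> bloch_seminorm f + bloch_seminorm h"
  proof (rule blochI(2))
    fix z :: complex assume z: "norm z < 1"
    have "(1 - (norm z)\<^sup>2) * norm (deriv f z - deriv h z)
        \<le> (1 - (norm z)\<^sup>2) * (norm (deriv f z) + norm (deriv h z))"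
      using one_minus_norm_sq_pos[OF z] by (intro mult_left_mono norm_triangle_ineq4) auto
    also have "\<dots> \<le> bloch_seminorm f + bloch_seminorm h"
      using bloch_seminorm_ge[OF f z] bloch_seminorm_ge[OF h z]
      by (simp add: distrib_left)
    finally show "(1 - (norm z)\<^sup>2) * norm (deriv (\<lambda>z. f z - h z) z) \<le> bloch_seminorm f + bloch_seminorm h"
      using f h z by (simp add: deriv_hol_disk_diff bloch_imp_hol_disk)
  qed (use f h in \<open>auto intro: hol_disk_diff bloch_imp_hol_disk\<close>)
  then show ?thesis
    using norm_triangle_ineq4[of "f 0" "h 0"] by (simp add: bloch_norm_def)
qed

lemma hinfI:
  assumes "f \<in> hol_disk" "\<And>z. norm z < 1 \<Longrightarrow> norm (f z) \<le> B"
  shows "f \<in> hinf" "hinf_norm f \<le> B"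
  using assms unfolding hinf_def hinf_norm_def bounded_iff by (auto intro!: cSUP_least exI[of _ B])

lemma hinf_norm_ge:
  assumes "f \<in> hinf" "norm z < 1"
  shows "norm (f z) \<le> hinf_norm f"
proof -
  have "bdd_above ((\<lambda>z. norm (f z)) ` disk)"
    using assms(1) unfolding hinf_def bounded_iff bdd_above_def by auto
  then show ?thesis
    unfolding hinf_norm_def using assms(2) by (auto intro: cSUP_upper)
qed

text \<open>Cauchy's estimate with radius \<open>(1 - |z|) / 2\<close> gives the factor
  \<open>2 (1 - |z|\<^sup>2) / (1 - |z|) \<le> 4\<close> for the seminorm; the value at \<open>0\<close> contributes one more.\<close>

lemma hinf_imp_bloch:
  assumes f: "f \<in> hinf"
  shows "f \<in> bloch" "bloch_norm f \<le> 5 * hinf_norm f"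
proof -
  have hd: "f \<in> hol_disk"
    using f by (simp add: hinf_def)
  have nn: "0 \<le> hinf_norm f"
    using hinf_norm_ge[OF f, of 0] order_trans[OF norm_ge_zero] by simp
  have *: "(1 - (norm z)\<^sup>2) * norm (deriv f z) \<le> 4 * hinf_norm f" if z: "norm z < 1" for z
  proof -
    have "norm (deriv f z) \<le> hinf_norm f / ((1 - norm z) / 2)"
      by (rule norm_deriv_le_of_bound_on_cball)
        (use z hd hinf_norm_ge[OF f] in \<open>auto simp: hol_diskD field_simps\<close>)
    then have "(1 - (norm z)\<^sup>2) * norm (deriv f z) \<le> (1 - (norm z)\<^sup>2) * (hinf_norm f / ((1 - norm z) / 2))"
      using one_minus_norm_sq_pos[OF z] by (intro mult_left_mono) auto
    also have "\<dots> = 2 * (1 + norm z) * hinf_norm f"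
      using z by (simp add: field_simps power2_eq_square)
    also have "\<dots> \<le> 4 * hinf_norm f"
      using z nn by (intro mult_right_mono) auto
    finally show ?thesis .
  qed
  show "f \<in> bloch"
    by (rule blochI(1)[OF hd *])
  have "bloch_seminorm f \<le> 4 * hinf_norm f"
    by (rule blochI(2)[OF hd *])
  then show "bloch_norm f \<le> 5 * hinf_norm f"
    using hinf_norm_ge[OF f, of 0] by (simp add: bloch_norm_def)
qed

section \<open>The commutator of a composition and an integral operator\<close>

definition commutator ::
  "(complex \<Rightarrow> complex) \<Rightarrow> (complex \<Rightarrow> complex) \<Rightarrow> (complex \<Rightarrow> complex) \<Rightarrow> complex \<Rightarrow> complex" where
  "commutator \<phi> g f = (\<lambda>z. comp_op \<phi> (int_op g f) z - int_op g (comp_op \<phi> f) z)"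

lemma holomorphic_on_deriv_mult:
  assumes "f \<in> hol_disk" "g \<in> hol_disk"
  shows "(\<lambda>z. deriv f z * g z) holomorphic_on disk"
  using assms by (auto intro!: holomorphic_intros holomorphic_deriv simp: hol_diskD(1))

lemma segment_subset_disk: "norm (z::complex) < 1 \<Longrightarrow> closed_segment 0 z \<subseteq> disk"
  by (rule closed_segment_subset) auto

lemma int_op_integrable:
  assumes "f \<in> hol_disk" "g \<in> hol_disk" "norm z < 1"
  shows "(\<lambda>z. deriv f z * g z) contour_integrable_on linepath 0 z"
  using holomorphic_on_deriv_mult[OF assms(1,2)] segment_subset_disk[OF assms(3)]
  by (intro contour_integrable_continuous_linepath)
    (meson continuous_on_subset holomorphic_on_imp_continuous_on)

text \<open>The integrand is holomorphic on a convex set, so it has a primitive, and the integral along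
  the segment from \<open>0\<close> is the primitive that vanishes at \<open>0\<close>.\<close>

lemma int_op:
  assumes f: "f \<in> hol_disk" and g: "g \<in> hol_disk"
  shows "int_op g f \<in> hol_disk" "int_op g f 0 = 0"
    and "\<And>z. norm z < 1 \<Longrightarrow> (int_op g f has_field_derivative deriv f z * g z) (at z)"
proof -
  obtain P where P: "\<And>z. z \<in> disk \<Longrightarrow> (P has_field_derivative deriv f z * g z) (at z within disk)"
    using holomorphic_convex_primitive'[OF convex_ball open_ball holomorphic_on_deriv_mult[OF f g]]
    by blast
  have eq: "int_op g f z = P z - P 0" if "norm z < 1" for z
  proof -
    have "((\<lambda>z. deriv f z * g z) has_contour_integral (P z - P 0)) (linepath 0 z)"
      using contour_integral_primitive[OF P valid_path_linepath, of 0 z]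
        segment_subset_disk[OF that] by simp
    then show ?thesis
      using that by (simp add: int_op_def on_disk_def contour_integral_unique)
  qed
  show der: "(int_op g f has_field_derivative deriv f z * g z) (at z)" if z: "norm z < 1" for z
  proof -
    have zd: "z \<in> disk" using z by simp
    have "(P has_field_derivative deriv f z * g z) (at z)"
      using P[OF zd] unfolding at_within_open[OF zd open_ball] .
    from DERIV_diff[OF this DERIV_const[of "P 0"]]
    have "((\<lambda>z. P z - P 0) has_field_derivative deriv f z * g z) (at z)"
      by simp
    then show ?thesis
      by (rule has_field_derivative_transform_within_open[OF _ open_ball zd]) (simp add: eq)
  qed
  show "int_op g f 0 = 0"
    using eq[of 0] by simp
  have "int_op g f holomorphic_on disk"
    unfolding holomorphic_on_open[OF open_ball] using der by (metis mem_ball_0)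
  then show "int_op g f \<in> hol_disk"
    by (simp add: hol_disk_def int_op_def on_disk_def)
qed

lemma int_op_add:
  assumes "f \<in> hol_disk" "h \<in> hol_disk" "g \<in> hol_disk"
  shows "int_op g (\<lambda>z. f z + h z) = (\<lambda>z. int_op g f z + int_op g h z)"
proof
  fix z
  have "contour_integral (linepath 0 z) (\<lambda>\<zeta>. deriv (\<lambda>z. f z + h z) \<zeta> * g \<zeta>) =
      contour_integral (linepath 0 z) (\<lambda>\<zeta>. deriv f \<zeta> * g \<zeta> + deriv h \<zeta> * g \<zeta>)" if "norm z < 1"
    using segment_subset_disk[OF that] assms
    by (intro contour_integral_eq) (auto simp: deriv_hol_disk_add distrib_right subset_iff)
  then show "int_op g (\<lambda>z. f z + h z) z = int_op g f z + int_op g h z"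
    using assms by (simp add: int_op_def on_disk_def contour_integral_add int_op_integrable)
qed

lemma int_op_scale:
  assumes "f \<in> hol_disk" "g \<in> hol_disk"
  shows "int_op g (\<lambda>z. c * f z) = (\<lambda>z. c * int_op g f z)"
proof
  fix z
  have "contour_integral (linepath 0 z) (\<lambda>\<zeta>. deriv (\<lambda>z. c * f z) \<zeta> * g \<zeta>) =
      contour_integral (linepath 0 z) (\<lambda>\<zeta>. c * (deriv f \<zeta> * g \<zeta>))" if "norm z < 1"
    using segment_subset_disk[OF that] assms
    by (intro contour_integral_eq) (auto simp: deriv_hol_disk_scale subset_iff)
  then show "int_op g (\<lambda>z. c * f z) z = c * int_op g f z"
    using assms by (simp add: int_op_def on_disk_def contour_integral_lmul int_op_integrable)
qed

lemma norm_int_op_le: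
  assumes f: "f \<in> hol_disk" and g: "g \<in> hol_disk" and w: "norm w < 1"
    and A: "\<And>z. norm z \<le> norm w \<Longrightarrow> norm (deriv f z) \<le> A"
    and B: "\<And>z. norm z < 1 \<Longrightarrow> norm (g z) \<le> B"
  shows "norm (int_op g f w) \<le> A * B"
proof -
  have A0: "0 \<le> A" and B0: "0 \<le> B"
    using order_trans[OF norm_ge_zero A[of 0]] order_trans[OF norm_ge_zero B[of 0]] by auto
  have "norm (int_op g f w - int_op g f 0) \<le> (A * B) * norm (w - 0)"
  proof (rule field_differentiable_bound[OF convex_cball])
    fix z :: complex assume z: "z \<in> cball 0 (norm w)"
    show "(int_op g f has_field_derivative deriv f z * g z) (at z within cball 0 (norm w))"
      by (rule has_field_derivative_at_within, rule int_op(3)[OF f g]) (use z w in simp)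
    show "norm (deriv f z * g z) \<le> A * B"
      unfolding norm_mult using z w A0 by (intro mult_mono A B) auto
  qed auto
  also have "\<dots> \<le> A * B * 1"
    using A0 B0 w by (intro mult_left_mono) auto
  finally show ?thesis
    by (simp add: int_op(2)[OF f g])
qed

context
  fixes \<phi> :: "complex \<Rightarrow> complex"
  assumes \<phi>: "\<phi> \<in> self_maps"
begin

lemma self_map_lt_1: "norm z < 1 \<Longrightarrow> norm (\<phi> z) < 1"
  using \<phi> by (auto simp: self_maps_def image_subset_iff)

lemma self_map_holomorphic: "\<phi> holomorphic_on disk"
  using \<phi> by (simp add: self_maps_def)

lemma comp_op_hol_disk:
  assumes "f \<in> hol_disk"
  shows "comp_op \<phi> f \<in> hol_disk"
proof -
  have "\<phi> ` disk \<subseteq> disk"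
    using \<phi> by (simp add: self_maps_def)
  then have "f \<circ> \<phi> holomorphic_on disk"
    using assms by (intro holomorphic_on_compose_gen[OF self_map_holomorphic]) (auto simp: hol_diskD)
  then show ?thesis
    unfolding comp_op_def by (rule hol_disk_on_disk)
qed

lemma deriv_comp_op:
  assumes f: "f \<in> hol_disk" and z: "norm z < 1"
  shows "deriv (comp_op \<phi> f) z = deriv f (\<phi> z) * deriv \<phi> z"
proof -
  have "(\<phi> has_field_derivative deriv \<phi> z) (at z)"
    using z by (intro holomorphic_derivI[OF self_map_holomorphic]) auto
  then have "((f \<circ> \<phi>) has_field_derivative deriv f (\<phi> z) * deriv \<phi> z) (at z)"
    using hol_diskD(2)[OF f self_map_lt_1[OF z]] by (intro DERIV_chain)
  then show ?thesis
    unfolding comp_op_def using z by (simp add: deriv_on_disk DERIV_imp_deriv)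
qed

lemma commutator_hol_disk:
  "f \<in> hol_disk \<Longrightarrow> g \<in> hol_disk \<Longrightarrow> commutator \<phi> g f \<in> hol_disk"
  unfolding commutator_def by (intro hol_disk_diff comp_op_hol_disk int_op)

lemma deriv_commutator:
  assumes f: "f \<in> hol_disk" and g: "g \<in> hol_disk" and z: "norm z < 1"
  shows "deriv (commutator \<phi> g f) z = deriv f (\<phi> z) * deriv \<phi> z * (g (\<phi> z) - g z)"
proof -
  note I = int_op[OF f g] and J = int_op[OF comp_op_hol_disk[OF f] g]
  have "deriv (commutator \<phi> g f) z = deriv (comp_op \<phi> (int_op g f)) z - deriv (int_op g (comp_op \<phi> f)) z"
    unfolding commutator_def using I J z by (intro deriv_hol_disk_diff comp_op_hol_disk)
  also have "deriv (comp_op \<phi> (int_op g f)) z = deriv f (\<phi> z) * g (\<phi> z) * deriv \<phi> z"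
    using I(1) I(3)[OF self_map_lt_1[OF z]] z by (simp add: deriv_comp_op DERIV_imp_deriv)
  also have "deriv (int_op g (comp_op \<phi> f)) z = deriv f (\<phi> z) * deriv \<phi> z * g z"
    using J(3)[OF z] f z by (simp add: deriv_comp_op DERIV_imp_deriv)
  finally show ?thesis
    by (simp add: algebra_simps)
qed

lemma commutator_0:
  assumes "f \<in> hol_disk" "g \<in> hol_disk"
  shows "commutator \<phi> g f 0 = int_op g f (\<phi> 0)"
  using int_op(2)[OF comp_op_hol_disk[OF assms(1)] assms(2)] by (simp add: commutator_def comp_op_def on_disk_def)

text \<open>The factor \<open>1 - |\<phi>(z)|\<^sup>2\<close> is moved from the hyperbolic derivative to \<open>f'\<close>. This separates a
  quantity controlled by the Bloch norm of \<open>f\<close> from one that depends on \<open>\<phi>\<close> and \<open>g\<close> only.\<close>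

lemma weighted_deriv_commutator:
  assumes "f \<in> hol_disk" "g \<in> hol_disk" and z: "norm z < 1"
  shows "(1 - (norm z)\<^sup>2) * norm (deriv (commutator \<phi> g f) z) =
    ((1 - (norm (\<phi> z))\<^sup>2) * norm (deriv f (\<phi> z))) * (norm (hyp_deriv \<phi> z) * norm (g (\<phi> z) - g z))"
proof -
  have "norm (hyp_deriv \<phi> z) = (1 - (norm z)\<^sup>2) / (1 - (norm (\<phi> z))\<^sup>2) * norm (deriv \<phi> z)"
    using one_minus_norm_sq_pos[OF z] one_minus_norm_sq_pos[OF self_map_lt_1[OF z]]
    unfolding hyp_deriv_def norm_mult norm_of_real by simp
  then show ?thesis
    using one_minus_norm_sq_pos[OF self_map_lt_1[OF z]] unfolding deriv_commutator[OF assms]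
    by (simp add: norm_mult)
qed

lemma commutator_add:
  assumes "f \<in> hol_disk" "h \<in> hol_disk" "g \<in> hol_disk"
  shows "commutator \<phi> g (\<lambda>z. f z + h z) = (\<lambda>z. commutator \<phi> g f z + commutator \<phi> g h z)"
proof -
  have C: "comp_op \<phi> (\<lambda>z. u z + v z) = (\<lambda>z. comp_op \<phi> u z + comp_op \<phi> v z)" for u v
    by (auto simp: comp_op_def on_disk_def)
  show ?thesis
    using assms by (simp add: commutator_def C int_op_add comp_op_hol_disk algebra_simps)
qed

lemma commutator_scale:
  assumes "f \<in> hol_disk" "g \<in> hol_disk"
  shows "commutator \<phi> g (\<lambda>z. c * f z) = (\<lambda>z. c * commutator \<phi> g f z)"
proof -
  have C: "comp_op \<phi> (\<lambda>z. c * u z) = (\<lambda>z. c * comp_op \<phi> u z)" for u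
    by (auto simp: comp_op_def on_disk_def)
  show ?thesis
    using assms by (simp add: commutator_def C int_op_scale comp_op_hol_disk algebra_simps)
qed

lemma commutator_diff:
  assumes "f \<in> hol_disk" "h \<in> hol_disk" "g \<in> hol_disk"
  shows "commutator \<phi> g (\<lambda>z. f z - h z) = (\<lambda>z. commutator \<phi> g f z - commutator \<phi> g h z)"
  using commutator_add[of f "\<lambda>z. (-1) * h z" g] commutator_scale[of h g "-1"] hol_disk_scale[of h "-1"] assms
  by (auto simp: fun_eq_iff)

lemma commutator_bloch:
  assumes f: "f \<in> bloch" and g: "g \<in> hinf"
  shows "commutator \<phi> g f \<in> bloch"
proof (rule blochI(1))
  have gd: "g \<in> hol_disk" and fd: "f \<in> hol_disk"
    using f g by (auto simp: hinf_def bloch_def)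
  show "commutator \<phi> g f \<in> hol_disk"
    by (rule commutator_hol_disk[OF fd gd])
  fix z :: complex assume z: "norm z < 1"
  have "norm (g (\<phi> z) - g z) \<le> 2 * hinf_norm g"
    using norm_triangle_ineq4[of "g (\<phi> z)" "g z"] hinf_norm_ge[OF g z]
      hinf_norm_ge[OF g self_map_lt_1[OF z]] by simp
  then show "(1 - (norm z)\<^sup>2) * norm (deriv (commutator \<phi> g f) z) \<le> bloch_seminorm f * (1 * (2 * hinf_norm g))"
    unfolding weighted_deriv_commutator[OF fd gd z]
    using bloch_seminorm_nonneg[OF f]
    by (intro mult_mono bloch_seminorm_ge f self_map_lt_1 z hyp_deriv_le_1 \<phi>) auto
qed

end


section \<open>Compactness in the Bloch norm\<close>

lemma limitin_bloch_iff:
  assumes "range \<sigma> \<subseteq> bloch"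
  shows "limitin (norm_topology bloch bloch_norm) \<sigma> l sequentially \<longleftrightarrow>
    l \<in> bloch \<and> (\<lambda>n. bloch_norm (\<lambda>z. \<sigma> n z - l z)) \<longlonglongrightarrow> 0"
proof -
  have "norm (bloch_norm (\<lambda>z. \<sigma> n z - l z)) = norm_dist bloch bloch_norm (\<sigma> n) l" if "l \<in> bloch" for n
  proof -
    have "0 \<le> bloch_norm (\<lambda>z. \<sigma> n z - l z)"
      using order_trans[OF norm_ge_zero bloch_norm_ge(1)[OF bloch_diff, of "\<sigma> n" l]] assms that by blast
    then show ?thesis
      using assms that by (auto simp: norm_dist_def)
  qed
  then show ?thesis
    unfolding norm_topology_def Metric_space.limitin_metric[OF Metric_space_bloch] tendsto_iff dist_norm
    using assms by (auto simp: range_subsetD)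
qed

lemma compactin_bloch_iff:
  "compactin (norm_topology bloch bloch_norm) S \<longleftrightarrow> S \<subseteq> bloch \<and>
    (\<forall>\<sigma>::nat \<Rightarrow> _. range \<sigma> \<subseteq> S \<longrightarrow> (\<exists>l r. l \<in> S \<and> strict_mono r \<and>
      (\<lambda>n. bloch_norm (\<lambda>z. \<sigma> (r n) z - l z)) \<longlonglongrightarrow> 0))"
proof (cases "S \<subseteq> bloch")
  case True
  have *: "limitin (norm_topology bloch bloch_norm) (\<sigma> \<circ> r) l sequentially \<longleftrightarrow>
      (\<lambda>n. bloch_norm (\<lambda>z. \<sigma> (r n) z - l z)) \<longlonglongrightarrow> 0"
    if "range \<sigma> \<subseteq> S" "l \<in> S" for \<sigma> :: "nat \<Rightarrow> complex \<Rightarrow> complex" and l r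
  proof -
    have "range (\<sigma> \<circ> r) \<subseteq> bloch" "l \<in> bloch"
      using that True by auto
    then show ?thesis
      using limitin_bloch_iff[of "\<sigma> \<circ> r" l] by simp
  qed
  show ?thesis
    unfolding Metric_space.compactin_sequentially[OF Metric_space_bloch, folded norm_topology_def]
    by (simp only: True * cong: conj_cong imp_cong)
next
  case False
  then show ?thesis
    using Metric_space.compactin_sequentially[OF Metric_space_bloch, folded norm_topology_def, of S] by simp
qed

lemma compactin_bloch_subseq:
  fixes \<sigma> :: "nat \<Rightarrow> complex \<Rightarrow> complex"
  assumes "compactin (norm_topology bloch bloch_norm) S" "range \<sigma> \<subseteq> S"
  obtains l r where "l \<in> bloch" "strict_mono (r :: nat \<Rightarrow> nat)"
    "(\<lambda>n. bloch_norm (\<lambda>z. \<sigma> (r n) z - l z)) \<longlonglongrightarrow> 0"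
  using assms unfolding compactin_bloch_iff by blast

lemma subset_closure_of_bloch:
  "S \<subseteq> bloch \<Longrightarrow> S \<subseteq> norm_topology bloch bloch_norm closure_of S"
  unfolding norm_topology_def
  by (rule closure_of_subset) (simp add: Metric_space.topspace_mtopology[OF Metric_space_bloch])

lemma closure_of_compactin_bloch:
  assumes "compactin (norm_topology bloch bloch_norm) S"
  shows "norm_topology bloch bloch_norm closure_of S = S"
  using compactin_imp_closedin[OF Metric_space.Hausdorff_space_mtopology[OF Metric_space_bloch]] assms
  unfolding norm_topology_def by (simp add: closure_of_eq)

section \<open>Normal families in the Bloch space\<close>

text \<open>The derivative is at most \<open>C / (1 - r\<^sup>2)\<close> on the disk of radius \<open>r\<close>, and the growth from
  the origin is at most that, by the mean value inequality. Hence Bloch balls are normal families.\<close>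

lemma norm_le_of_bloch_norm_le:
  assumes f: "f \<in> bloch" and C: "bloch_norm f \<le> C" and r: "r < 1" and z: "norm z \<le> r"
  shows "norm (f z) \<le> C + C / (1 - r\<^sup>2)"
proof -
  have r0: "0 \<le> r" using order_trans[OF norm_ge_zero z] .
  have r2: "0 < 1 - r\<^sup>2" using r r0 by (simp add: abs_square_less_1)
  have C0: "0 \<le> C" using order_trans[OF norm_ge_zero order_trans[OF bloch_norm_ge(1)[OF f] C]] .
  have "norm (f z - f 0) \<le> C / (1 - r\<^sup>2) * norm (z - 0)"
  proof (rule field_differentiable_bound[OF convex_cball])
    fix w :: complex assume "w \<in> cball 0 r"
    then have w: "norm w \<le> r" by simp
    then have w1: "norm w < 1" using r by simp
    show "(f has_field_derivative deriv f w) (at w within cball 0 r)"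
      using hol_diskD(2)[OF bloch_imp_hol_disk[OF f] w1] by (rule has_field_derivative_at_within)
    have "(1 - r\<^sup>2) * norm (deriv f w) \<le> (1 - (norm w)\<^sup>2) * norm (deriv f w)"
      using w by (intro mult_right_mono) (auto intro: power_mono)
    then show "norm (deriv f w) \<le> C / (1 - r\<^sup>2)"
      using bloch_norm_ge(3)[OF f w1] C r2 by (simp add: pos_le_divide_eq mult.commute)
  qed (use z r0 in auto)
  also have "\<dots> \<le> C / (1 - r\<^sup>2) * 1"
    using C0 r2 z r by (intro mult_left_mono) auto
  finally show ?thesis
    using norm_triangle_ineq2[of "f z" "f 0"] bloch_norm_ge(1)[OF f] C by linarith
qed

lemma compact_subset_disk_cball:
  assumes "compact K" "K \<subseteq> disk"
  obtains r where "r < 1" "K \<subseteq> cball 0 r"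
proof (cases "K = {}")
  case True
  then show ?thesis using that[of 0] by simp
next
  case False
  have "continuous_on K norm" by (intro continuous_intros)
  then obtain x where "x \<in> K" "\<And>y. y \<in> K \<Longrightarrow> norm y \<le> norm x"
    using continuous_attains_sup[OF assms(1) False] by blast
  then show ?thesis
    using that[of "norm x"] assms(2) by force
qed

lemma bloch_ball_Montel:
  fixes F :: "nat \<Rightarrow> complex \<Rightarrow> complex"
  assumes F: "\<And>n. F n \<in> bloch" "\<And>n. bloch_norm (F n) \<le> C"
  obtains f r where "f \<in> hol_disk" "strict_mono (r :: nat \<Rightarrow> nat)"
    "\<And>\<rho>. \<rho> < 1 \<Longrightarrow> uniform_limit (cball 0 \<rho>) (\<lambda>n. F (r n)) f sequentially"
proof -
  have bdd: "\<exists>B. \<forall>h\<in>range F. \<forall>z\<in>K. norm (h z) \<le> B" if K: "compact K" "K \<subseteq> disk" for K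
  proof -
    obtain r where r: "r < 1" "K \<subseteq> cball 0 r"
      using compact_subset_disk_cball[OF K] by metis
    then show ?thesis
      using norm_le_of_bloch_norm_le[OF F r(1)] by (intro exI[of _ "C + C / (1 - r\<^sup>2)"]) fastforce
  qed
  have hol: "h holomorphic_on disk" if "h \<in> range F" for h
    using that F by (auto intro: hol_diskD bloch_imp_hol_disk)
  obtain g and r :: "nat \<Rightarrow> nat" where g: "g holomorphic_on disk" and r: "strict_mono r"
    and lim: "\<And>K. compact K \<Longrightarrow> K \<subseteq> disk \<Longrightarrow> uniform_limit K (F \<circ> r) g sequentially"
    by (rule Montel[of disk "range F" F]) (use hol bdd in auto)
  have "uniform_limit (cball 0 \<rho>) (\<lambda>n. F (r n)) (on_disk g) sequentially" if "\<rho> < 1" for \<rho>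
  proof -
    have "uniform_limit (cball 0 \<rho>) (F \<circ> r) g sequentially"
      using that by (intro lim) auto
    moreover have "on_disk g z = g z" if "z \<in> cball 0 \<rho>" for z
      using that \<open>\<rho> < 1\<close> by (auto simp: on_disk_def)
    ultimately show ?thesis
      by (subst uniform_limit_cong'[of "cball 0 \<rho>" _ "F \<circ> r" _ g]) simp_all
  qed
  then show ?thesis
    using that hol_disk_on_disk[OF g] r by blast
qed

lemma deriv_uniformly_small:
  assumes h: "\<And>n. h n \<in> hol_disk"
    and lim: "\<And>s. s < 1 \<Longrightarrow> uniform_limit (cball 0 s) h (\<lambda>_. 0) sequentially"
    and "\<rho> < 1" "\<delta> > 0"
  shows "\<forall>\<^sub>F n in sequentially. \<forall>z. norm z \<le> \<rho> \<longrightarrow> norm (deriv (h n) z) \<le> \<delta>"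
proof -
  define s where "s = (1 - \<rho>) / 2"
  have s: "0 < s" "\<rho> + s < 1"
    using assms by (auto simp: s_def field_simps)
  have "\<forall>\<^sub>F n in sequentially. \<forall>u\<in>cball 0 (\<rho> + s). dist (h n u) 0 < \<delta> * s"
    using uniform_limitD[OF lim[OF s(2)], of "\<delta> * s"] s(1) assms(4) by simp
  then show ?thesis
  proof eventually_elim
    case (elim n)
    have "norm (deriv (h n) z) \<le> (\<delta> * s) / s" if z: "norm z \<le> \<rho>" for z
    proof (rule norm_deriv_le_of_bound_on_cball)
      show "norm (h n u) \<le> \<delta> * s" if "norm u \<le> norm z + s" for u
        using elim[rule_format, of u] that z by simp
    qed (use s z h in \<open>auto simp: hol_diskD\<close>)
    then show ?case using s by simp
  qed
qed

lemma deriv_tendsto_of_locally_uniform: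
  assumes h: "\<And>n. h n \<in> hol_disk"
    and lim: "\<And>s. s < 1 \<Longrightarrow> uniform_limit (cball 0 s) h f sequentially" and z: "norm z < 1"
  shows "(\<lambda>n. deriv (h n) z) \<longlonglongrightarrow> deriv f z"
proof -
  obtain s where s: "norm z < s" "s < 1" using dense[OF z] by blast
  have "uniform_limit (ball 0 s) h f sequentially"
    using uniform_limit_on_subset[OF lim[OF s(2)] ball_subset_cball] .
  moreover have "h n holomorphic_on ball 0 s" for n
    using hol_diskD(1)[OF h[of n]] by (rule holomorphic_on_subset) (use s in auto)
  ultimately show ?thesis
    using s by (intro deriv_complex_uniform_limit[where A = "ball 0 s"]) auto
qed

section \<open>Spaces whose unit ball is closed under locally uniform limits\<close>

text \<open>In \<open>ball_closed\<close>, convergence of the values and of the derivatives is only required pointwise,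
  which is what one checks; locally uniform convergence implies both. The constants \<open>5\<close> and
  \<open>1/5\<close> come from the embedding of the bounded functions into the Bloch space.\<close>

locale disk_function_space =
  fixes X :: "(complex \<Rightarrow> complex) set" and nX :: "(complex \<Rightarrow> complex) \<Rightarrow> real"
  assumes subset_bloch: "X \<subseteq> bloch"
    and ball_bloch_norm: "f \<in> X \<Longrightarrow> nX f \<le> 1 \<Longrightarrow> bloch_norm f \<le> 5"
    and small_hinf_in_ball: "f \<in> hinf \<Longrightarrow> hinf_norm f \<le> 1/5 \<Longrightarrow> f \<in> X \<and> nX f \<le> 1"
    and ball_closed: "(\<And>n::nat. F n \<in> X \<and> nX (F n) \<le> 1) \<Longrightarrow> f \<in> hol_disk \<Longrightarrow>
      (\<And>z. norm z < 1 \<Longrightarrow> (\<lambda>n. F n z) \<longlonglongrightarrow> f z) \<Longrightarrow>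
      (\<And>z. norm z < 1 \<Longrightarrow> (\<lambda>n. deriv (F n) z) \<longlonglongrightarrow> deriv f z) \<Longrightarrow> f \<in> X \<and> nX f \<le> 1"

lemma disk_function_space_hinf: "disk_function_space hinf hinf_norm"
proof
  show "hinf \<subseteq> bloch"
    using hinf_imp_bloch by blast
  show "bloch_norm f \<le> 5" if "f \<in> hinf" "hinf_norm f \<le> 1" for f
    using hinf_imp_bloch(2)[OF that(1)] that(2) by simp
  show "f \<in> hinf \<and> hinf_norm f \<le> 1" if "f \<in> hinf" "hinf_norm f \<le> 1/5" for f
    using that by simp
  fix F :: "nat \<Rightarrow> complex \<Rightarrow> complex" and f
  assume F: "\<And>n. F n \<in> hinf \<and> hinf_norm (F n) \<le> 1" and f: "f \<in> hol_disk"
    and lim: "\<And>z. norm z < 1 \<Longrightarrow> (\<lambda>n. F n z) \<longlonglongrightarrow> f z"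
  have "norm (f z) \<le> 1" if z: "norm z < 1" for z
  proof (rule Lim_norm_ubound[OF _ lim[OF z]])
    show "\<forall>\<^sub>F n in sequentially. norm (F n z) \<le> 1"
      using F hinf_norm_ge[OF _ z] by (intro always_eventually) (meson order_trans)
  qed simp
  then show "f \<in> hinf \<and> hinf_norm f \<le> 1"
    using hinfI[OF f] by blast
qed

lemma disk_function_space_bloch: "disk_function_space bloch bloch_norm"
proof
  show "f \<in> bloch \<and> bloch_norm f \<le> 1" if "f \<in> hinf" "hinf_norm f \<le> 1/5" for f
    using hinf_imp_bloch[OF that(1)] that(2) by simp
  fix F :: "nat \<Rightarrow> complex \<Rightarrow> complex" and f
  assume F: "\<And>n. F n \<in> bloch \<and> bloch_norm (F n) \<le> 1" and f: "f \<in> hol_disk"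
    and lim: "\<And>z. norm z < 1 \<Longrightarrow> (\<lambda>n. F n z) \<longlonglongrightarrow> f z"
    and dlim: "\<And>z. norm z < 1 \<Longrightarrow> (\<lambda>n. deriv (F n) z) \<longlonglongrightarrow> deriv f z"
  have *: "(1 - (norm z)\<^sup>2) * norm (deriv f z) \<le> 1 - norm (f 0)" if z: "norm z < 1" for z
  proof (rule LIMSEQ_le)
    show "(\<lambda>n. (1 - (norm z)\<^sup>2) * norm (deriv (F n) z)) \<longlonglongrightarrow> (1 - (norm z)\<^sup>2) * norm (deriv f z)"
      by (intro tendsto_intros dlim z)
    show "(\<lambda>n. 1 - norm (F n 0)) \<longlonglongrightarrow> 1 - norm (f 0)"
      by (intro tendsto_intros lim) simp
    have "(1 - (norm z)\<^sup>2) * norm (deriv (F n) z) \<le> 1 - norm (F n 0)" for n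
      using F[of n] bloch_seminorm_ge[OF _ z, of "F n"] by (simp add: bloch_norm_def)
    then show "\<exists>N. \<forall>n\<ge>N. (1 - (norm z)\<^sup>2) * norm (deriv (F n) z) \<le> 1 - norm (F n 0)"
      by blast
  qed
  show "f \<in> bloch \<and> bloch_norm f \<le> 1"
    using blochI[OF f *] by (simp add: bloch_norm_def)
qed auto

section \<open>Sufficiency of the boundary condition\<close>

text \<open>Given \<open>\<epsilon>\<close>, let \<open>\<delta>\<close> be a modulus of uniform continuity of \<open>g\<close>. Where
  \<open>|\<phi>(z) - z| < \<delta>\<close> the difference of \<open>g\<close> is below \<open>\<epsilon>\<close> and the hyperbolic derivative is at most
  \<open>1\<close>; where \<open>|\<phi>(z) - z| \<ge> \<delta>\<close>, dividing the hypothesis by \<open>\<delta>\<close> shows that the hyperbolic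
  derivative is small, and the difference of \<open>g\<close> is bounded.\<close>

lemma vanishes_for_disk_algebra:
  assumes \<phi>: "\<phi> \<in> self_maps" and g: "g \<in> disk_algebra"
    and van: "vanishes_when_near_circle \<phi> (\<lambda>z. norm (hyp_deriv \<phi> z) * norm (\<phi> z - z))"
  shows "vanishes_when_near_circle \<phi> (\<lambda>z. norm (hyp_deriv \<phi> z) * norm (g (\<phi> z) - g z))"
  unfolding vanishes_when_near_circle_def
proof (intro allI impI)
  fix \<epsilon> :: real assume \<epsilon>: "\<epsilon> > 0"
  have gh: "g \<in> hinf" using g by (simp add: disk_algebra_def)
  obtain G where G: "continuous_on (cball 0 1) G" "\<And>z. z \<in> disk \<Longrightarrow> G z = g z"
    using g by (auto simp: disk_algebra_def)
  have "uniformly_continuous_on (cball 0 1) G"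
    using G(1) by (intro compact_uniformly_continuous) auto
  then obtain \<delta> where \<delta>: "\<delta> > 0"
    and uc: "\<And>x y. x \<in> cball 0 1 \<Longrightarrow> y \<in> cball 0 1 \<Longrightarrow> dist x y < \<delta> \<Longrightarrow> dist (G x) (G y) < \<epsilon>"
    using \<epsilon> unfolding uniformly_continuous_on_def by metis
  define B where "B = 2 * hinf_norm g + 1"
  have B: "norm (g u - g v) \<le> B" if "norm u < 1" "norm v < 1" for u v
    using norm_triangle_ineq4[of "g u" "g v"] hinf_norm_ge[OF gh that(1)] hinf_norm_ge[OF gh that(2)]
    by (simp add: B_def)
  have "0 < B"
    using order_trans[OF norm_ge_zero hinf_norm_ge[OF gh, of 0]] by (simp add: B_def)
  then have "\<delta> * (\<epsilon> / B) > 0" using \<delta> \<epsilon> by simp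
  then obtain r where r: "r \<in> {0<..<1}" and
    small: "\<And>z. z \<in> disk \<Longrightarrow> norm (\<phi> z) > r \<Longrightarrow>
      \<bar>norm (hyp_deriv \<phi> z) * norm (\<phi> z - z)\<bar> < \<delta> * (\<epsilon> / B)"
    using van unfolding vanishes_when_near_circle_def by metis
  have "norm (hyp_deriv \<phi> z) * norm (g (\<phi> z) - g z) < \<epsilon>" if z: "z \<in> disk" and zr: "norm (\<phi> z) > r" for z
  proof -
    have z1: "norm z < 1" and \<phi>z: "norm (\<phi> z) < 1"
      using z self_map_lt_1[OF \<phi>, of z] by auto
    show ?thesis
    proof (cases "norm (\<phi> z - z) < \<delta>")
      case True
      then have "norm (g (\<phi> z) - g z) < \<epsilon>"
        using uc[of "\<phi> z" z] G(2)[of z] G(2)[of "\<phi> z"] z1 \<phi>z by (simp add: dist_norm)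
      then show ?thesis
        using mult_right_mono[OF hyp_deriv_le_1[OF \<phi> z1], of "norm (g (\<phi> z) - g z)"] by simp
    next
      case False
      have "\<delta> * norm (hyp_deriv \<phi> z) \<le> norm (hyp_deriv \<phi> z) * norm (\<phi> z - z)"
        using False mult_left_mono[of \<delta> "norm (\<phi> z - z)" "norm (hyp_deriv \<phi> z)"] by (simp add: mult.commute)
      also have "\<dots> < \<delta> * (\<epsilon> / B)"
        using small[OF z zr] by simp
      finally have "norm (hyp_deriv \<phi> z) < \<epsilon> / B"
        by (simp only: mult_less_cancel_left_pos[OF \<delta>])
      then have "norm (hyp_deriv \<phi> z) * B < \<epsilon>"
        using \<open>0 < B\<close> by (simp add: pos_less_divide_eq)
      then show ?thesis
        using mult_left_mono[OF B[OF \<phi>z z1], of "norm (hyp_deriv \<phi> z)"] by simp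
    qed
  qed
  then show "\<exists>r\<in>{0<..<1}. \<forall>z\<in>disk. r < norm (\<phi> z) \<longrightarrow>
      \<bar>norm (hyp_deriv \<phi> z) * norm (g (\<phi> z) - g z)\<bar> < \<epsilon>"
    using r by (intro bexI[of _ r]) auto
qed

text \<open>The core of sufficiency: a locally uniform null sequence that is bounded in the Bloch norm is
  mapped to a null sequence in the Bloch norm. In the region \<open>|\<phi>(z)| > r\<close> smallness comes from the
  boundary condition; in the region \<open>|\<phi>(z)| \<le> r\<close> it comes from the derivatives of
  \<open>h\<^sub>n\<close> on the compact disk of radius \<open>r\<close>.\<close>

lemma commutator_norm_tendsto_0:
  fixes h :: "nat \<Rightarrow> complex \<Rightarrow> complex"
  assumes \<phi>: "\<phi> \<in> self_maps" and g: "g \<in> hinf"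
    and van: "vanishes_when_near_circle \<phi> (\<lambda>z. norm (hyp_deriv \<phi> z) * norm (g (\<phi> z) - g z))"
    and h: "\<And>n. h n \<in> bloch" "\<And>n. bloch_norm (h n) \<le> C"
    and lim: "\<And>s. s < 1 \<Longrightarrow> uniform_limit (cball 0 s) h (\<lambda>_. 0) sequentially"
  shows "(\<lambda>n. bloch_norm (commutator \<phi> g (h n))) \<longlonglongrightarrow> 0"
proof (rule tendstoI)
  fix \<epsilon> :: real assume \<epsilon>: "\<epsilon> > 0"
  have gd: "g \<in> hol_disk" using g by (simp add: hinf_def)
  have hd: "h n \<in> hol_disk" for n using h by (simp add: bloch_imp_hol_disk)
  have C0: "0 \<le> C"
    using order_trans[OF norm_ge_zero order_trans[OF bloch_norm_ge(1)[OF h(1)] h(2)]] .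
  define B where "B = hinf_norm g + 1"
  have gB: "norm (g z) \<le> B" if "norm z < 1" for z
    using hinf_norm_ge[OF g that] by (simp add: B_def)
  have B: "0 < B"
    using order_trans[OF norm_ge_zero hinf_norm_ge[OF g, of 0]] by (simp add: B_def)
  have "\<epsilon> / (3 * (C + 1)) > 0" using \<epsilon> C0 by simp
  then obtain r where r: "r \<in> {0<..<1}" and
    near: "\<And>z. z \<in> disk \<Longrightarrow> norm (\<phi> z) > r \<Longrightarrow>
      \<bar>norm (hyp_deriv \<phi> z) * norm (g (\<phi> z) - g z)\<bar> < \<epsilon> / (3 * (C + 1))"
    using van unfolding vanishes_when_near_circle_def by metis
  \<comment> \<open>The disk of radius \<open>\<rho>\<close> also contains the segment from \<open>0\<close> to \<open>\<phi> 0\<close>, over which the value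
    of the image at \<open>0\<close> is an integral.\<close>
  define \<rho> where "\<rho> = max r (norm (\<phi> 0))"
  have \<rho>: "\<rho> < 1" using r self_map_lt_1[OF \<phi>, of 0] by (simp add: \<rho>_def)
  define \<delta> where "\<delta> = \<epsilon> / (6 * B)"
  have \<delta>: "\<delta> > 0" using \<epsilon> B by (simp add: \<delta>_def)
  have \<delta>B: "\<delta> * B = \<epsilon> / 6" using B by (simp add: \<delta>_def)
  have "\<forall>\<^sub>F n in sequentially. \<forall>z. norm z \<le> \<rho> \<longrightarrow> norm (deriv (h n) z) \<le> \<delta>"
    by (rule deriv_uniformly_small[OF hd _ \<rho> \<delta>]) (rule lim)
  then show "\<forall>\<^sub>F n in sequentially. dist (bloch_norm (commutator \<phi> g (h n))) 0 < \<epsilon>"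
  proof eventually_elim
    case (elim n)
    have "norm (int_op g (h n) (\<phi> 0)) \<le> \<delta> * B"
      using elim self_map_lt_1[OF \<phi>, of 0] gB by (intro norm_int_op_le hd gd) (auto simp: \<rho>_def)
    then have at0: "norm (commutator \<phi> g (h n) 0) \<le> \<epsilon> / 6"
      by (simp only: commutator_0[OF \<phi> hd gd] \<delta>B)
    have semi: "bloch_seminorm (commutator \<phi> g (h n)) \<le> \<epsilon> / 3"
    proof (rule blochI(2)[OF commutator_hol_disk[OF \<phi> hd gd]])
      fix z :: complex assume z: "norm z < 1"
      have \<phi>z: "norm (\<phi> z) < 1" by (rule self_map_lt_1[OF \<phi> z])
      define L where "L = norm (hyp_deriv \<phi> z) * norm (g (\<phi> z) - g z)"
      define D where "D = (1 - (norm (\<phi> z))\<^sup>2) * norm (deriv (h n) (\<phi> z))"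
      have L0: "0 \<le> L"
        by (simp add: L_def)
      have "D * L \<le> \<epsilon> / 3"
      proof (cases "norm (\<phi> z) > r")
        case True
        have "D * L \<le> (C + 1) * (\<epsilon> / (3 * (C + 1)))"
        proof (rule mult_mono)
          show "D \<le> C + 1"
            using bloch_norm_ge(3)[OF h(1) \<phi>z, of n] h(2)[of n] by (simp add: D_def)
          show "L \<le> \<epsilon> / (3 * (C + 1))"
            using near[of z] z True by (simp add: L_def)
        qed (use C0 L0 in auto)
        also have "\<dots> = \<epsilon> / 3" using C0 by (simp add: field_simps)
        finally show ?thesis .
      next
        case False
        have "D \<le> 1 * \<delta>"
          unfolding D_def using elim False one_minus_norm_sq_pos[OF \<phi>z]
          by (intro mult_mono) (auto simp: \<rho>_def)
        moreover have "L \<le> 1 * (2 * B)"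
          unfolding L_def using norm_triangle_ineq4[of "g (\<phi> z)" "g z"] gB[OF z] gB[OF \<phi>z]
          by (intro mult_mono hyp_deriv_le_1 \<phi> z) auto
        ultimately have "D * L \<le> \<delta> * (2 * B)"
          using L0 \<delta> by (intro mult_mono) auto
        then show ?thesis using \<delta>B by simp
      qed
      then show "(1 - (norm z)\<^sup>2) * norm (deriv (commutator \<phi> g (h n)) z) \<le> \<epsilon> / 3"
        unfolding weighted_deriv_commutator[OF \<phi> hd gd z] D_def L_def .
    qed
    have "0 \<le> bloch_norm (commutator \<phi> g (h n))"
      using order_trans[OF norm_ge_zero bloch_norm_ge(1)[OF commutator_bloch[OF \<phi> h(1) g]]] .
    moreover have "bloch_norm (commutator \<phi> g (h n)) < \<epsilon>"
      unfolding bloch_norm_def using at0 semi \<epsilon> by linarith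
    ultimately show ?case by simp
  qed
qed

context disk_function_space
begin

lemma in_hol_disk: "f \<in> X \<Longrightarrow> f \<in> hol_disk"
  using subset_bloch bloch_imp_hol_disk by blast

text \<open>The image of the unit ball is sequentially compact, hence closed, so it is its own closure.\<close>

lemma compact_commutator:
  assumes \<phi>: "\<phi> \<in> self_maps" and g: "g \<in> hinf"
    and van: "vanishes_when_near_circle \<phi> (\<lambda>z. norm (hyp_deriv \<phi> z) * norm (g (\<phi> z) - g z))"
  shows "compact_operator X nX bloch bloch_norm (commutator \<phi> g)"
proof -
  let ?T = "commutator \<phi> g" and ?K = "{f \<in> X. nX f \<le> 1}"
  have gd: "g \<in> hol_disk" using g by (simp add: hinf_def)
  have into: "?T f \<in> bloch" if "f \<in> X" for f
    by (rule commutator_bloch[OF \<phi> subsetD[OF subset_bloch that] g])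
  have "\<exists>l r. l \<in> ?T ` ?K \<and> strict_mono r \<and> (\<lambda>n. bloch_norm (\<lambda>z. \<sigma> (r n) z - l z)) \<longlonglongrightarrow> 0"
    if \<sigma>: "range \<sigma> \<subseteq> ?T ` ?K" for \<sigma> :: "nat \<Rightarrow> complex \<Rightarrow> complex"
  proof -
    have "\<forall>n. \<exists>f. f \<in> X \<and> nX f \<le> 1 \<and> \<sigma> n = ?T f"
      using \<sigma> by blast
    then obtain F where F: "\<And>n. F n \<in> X" "\<And>n. nX (F n) \<le> 1" and \<sigma>F: "\<And>n. \<sigma> n = ?T (F n)"
      by metis
    have Fb: "F n \<in> bloch" "bloch_norm (F n) \<le> 5" for n
      using F subset_bloch ball_bloch_norm by auto
    obtain f and r :: "nat \<Rightarrow> nat" where f: "f \<in> hol_disk" and r: "strict_mono r"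
      and lim: "\<And>\<rho>. \<rho> < 1 \<Longrightarrow> uniform_limit (cball 0 \<rho>) (\<lambda>n. F (r n)) f sequentially"
      using bloch_ball_Montel[of F, OF Fb] by blast
    have fX: "f \<in> X \<and> nX f \<le> 1"
    proof (rule ball_closed[of "\<lambda>n. F (r n)"])
      show "(\<lambda>n. F (r n) z) \<longlonglongrightarrow> f z" if "norm z < 1" for z
        using tendsto_uniform_limitI[OF lim[OF that]] by simp
      show "(\<lambda>n. deriv (F (r n)) z) \<longlonglongrightarrow> deriv f z" if "norm z < 1" for z
        by (rule deriv_tendsto_of_locally_uniform[OF _ lim that]) (use F in \<open>auto intro: in_hol_disk\<close>)
    qed (use F f in auto)
    then have fb: "f \<in> bloch" "bloch_norm f \<le> 5"
      using subset_bloch ball_bloch_norm by auto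
    have "(\<lambda>n. bloch_norm (?T (\<lambda>z. F (r n) z - f z))) \<longlonglongrightarrow> 0"
    proof (rule commutator_norm_tendsto_0[OF \<phi> g van])
      show "(\<lambda>z. F (r n) z - f z) \<in> bloch" for n
        by (intro bloch_diff Fb fb)
      show "bloch_norm (\<lambda>z. F (r n) z - f z) \<le> 10" for n
        using bloch_norm_diff_le[OF Fb(1)[of "r n"] fb(1)] Fb(2)[of "r n"] fb(2) by simp
      show "uniform_limit (cball 0 s) (\<lambda>n z. F (r n) z - f z) (\<lambda>_. 0) sequentially" if "s < 1" for s
        using uniform_limit_minus[OF lim[OF that] uniform_limit_const[where c = f]] by simp
    qed
    then have "(\<lambda>n. bloch_norm (\<lambda>z. \<sigma> (r n) z - ?T f z)) \<longlonglongrightarrow> 0"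
      unfolding \<sigma>F by (simp only: commutator_diff[OF \<phi> in_hol_disk[OF F(1)] f gd])
    then show ?thesis
      using r fX by blast
  qed
  then have "compactin (norm_topology bloch bloch_norm) (?T ` ?K)"
    unfolding compactin_bloch_iff using into by blast
  then show ?thesis
    unfolding compact_operator_def
    using into commutator_add[OF \<phi> in_hol_disk in_hol_disk gd] commutator_scale[OF \<phi> in_hol_disk gd]
    by (auto simp: closure_of_compactin_bloch)
qed

end

section \<open>Necessity of the boundary condition\<close>

text \<open>The test function for the point \<open>w\<close>, a normalized Cauchy kernel whose pole approaches the disk
  as \<open>|w| \<rightarrow> 1\<close>. The denominator \<open>10\<close> makes the supremum norm at most \<open>1/5\<close>.\<close>

definition peak :: "complex \<Rightarrow> complex \<Rightarrow> complex" where
  "peak w = on_disk (\<lambda>z. of_real ((1 - (norm w)\<^sup>2) / 10) / (1 - cnj w * z))"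

lemma norm_one_minus_cnj_mult_ge:
  assumes "norm w < 1" "norm z < 1"
  shows "1 - norm z \<le> norm (1 - cnj w * z)" "1 - norm w \<le> norm (1 - cnj w * z)"
proof -
  have "1 - norm (cnj w * z) \<le> norm (1 - cnj w * z)"
    using norm_triangle_ineq2[of 1 "cnj w * z"] by simp
  moreover have "norm (cnj w * z) \<le> norm z" "norm (cnj w * z) \<le> norm w"
    unfolding norm_mult complex_mod_cnj
    using mult_right_mono[of "norm w" 1 "norm z"] mult_left_mono[of "norm z" 1 "norm w"] assms by auto
  ultimately show "1 - norm z \<le> norm (1 - cnj w * z)" "1 - norm w \<le> norm (1 - cnj w * z)"
    by auto
qed

lemma one_minus_cnj_mult_nonzero: "norm w < 1 \<Longrightarrow> norm z < 1 \<Longrightarrow> 1 - cnj w * z \<noteq> 0"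
  using norm_one_minus_cnj_mult_ge(1)[of w z] by auto

lemma peak_hol_disk: "norm w < 1 \<Longrightarrow> peak w \<in> hol_disk"
  unfolding peak_def using one_minus_cnj_mult_nonzero
  by (intro hol_disk_on_disk holomorphic_intros) auto

lemma deriv_peak:
  assumes w: "norm w < 1" and z: "norm z < 1"
  shows "deriv (peak w) z = of_real ((1 - (norm w)\<^sup>2) / 10) * cnj w / (1 - cnj w * z)\<^sup>2"
proof -
  have D: "((\<lambda>z. 1 - cnj w * z) has_field_derivative - cnj w) (at z)"
    by (auto intro!: derivative_eq_intros)
  have "deriv (\<lambda>z. c / (1 - cnj w * z)) z = c * cnj w / (1 - cnj w * z)\<^sup>2" for c
    using DERIV_imp_deriv[OF DERIV_quotient[OF DERIV_const[of c] D one_minus_cnj_mult_nonzero[OF w z]]]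
    by (simp add: mult.commute power2_eq_square)
  then show ?thesis
    unfolding peak_def deriv_on_disk[OF z] .
qed

lemma norm_deriv_peak:
  assumes "norm w < 1" "norm z < 1"
  shows "norm (deriv (peak w) z) = (1 - (norm w)\<^sup>2) / 10 * norm w / (norm (1 - cnj w * z))\<^sup>2"
  unfolding deriv_peak[OF assms] norm_mult norm_divide norm_power norm_of_real complex_mod_cnj
  using one_minus_norm_sq_pos[OF assms(1)] by simp

text \<open>At a fixed \<open>z\<close> this bound tends to \<open>0\<close> as \<open>|w| \<rightarrow> 1\<close>, in contrast to the value at \<open>w\<close> itself
  in \<open>weighted_deriv_peak\<close>.\<close>

lemma norm_deriv_peak_le:
  assumes w: "norm w < 1" and z: "norm z < 1"
  shows "norm (deriv (peak w) z) \<le> (1 - (norm w)\<^sup>2) / 10 / (1 - norm z)\<^sup>2"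
  unfolding norm_deriv_peak[OF assms]
  using norm_one_minus_cnj_mult_ge(1)[OF assms] assms one_minus_norm_sq_pos[OF w]
  by (intro frac_le power_mono) (auto intro: mult_left_le)

lemma weighted_deriv_peak:
  assumes w: "norm w < 1"
  shows "(1 - (norm w)\<^sup>2) * norm (deriv (peak w) w) = norm w / 10"
proof -
  have "1 - cnj w * w = of_real (1 - (norm w)\<^sup>2)"
    unfolding of_real_diff complex_norm_square by (simp add: mult.commute)
  then have "norm (1 - cnj w * w) = 1 - (norm w)\<^sup>2"
    using one_minus_norm_sq_pos[OF w] by (simp only: norm_of_real)
  moreover have "d * (d / 10 * b / d\<^sup>2) = b / 10" if "0 < d" for b d :: real
    using that by (simp add: power2_eq_square)
  ultimately show ?thesis
    unfolding norm_deriv_peak[OF w w] using one_minus_norm_sq_pos[OF w] by metis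
qed

lemma norm_peak_le:
  assumes w: "norm w < 1" and z: "norm z < 1"
  shows "norm (peak w z) \<le> 1 / 5"
proof -
  have "norm (peak w z) = (1 - (norm w)\<^sup>2) / 10 / norm (1 - cnj w * z)"
    unfolding peak_def on_disk_def using one_minus_norm_sq_pos[OF w] z
    by (simp only: mem_ball_0 if_True norm_divide norm_of_real abs_of_pos zero_less_divide_iff) simp
  also have "\<dots> \<le> (1 - (norm w)\<^sup>2) / 10 / (1 - norm w)"
    using norm_one_minus_cnj_mult_ge(2)[OF w z] one_minus_norm_sq_pos[OF w] w
      one_minus_cnj_mult_nonzero[OF w z]
    by (intro divide_left_mono mult_pos_pos) auto
  also have "\<dots> = (1 + norm w) / 10"
    using w by (simp add: power2_eq_square field_simps)
  also have "\<dots> \<le> 1 / 5" using w by simp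
  finally show ?thesis .
qed

lemma peak_hinf:
  assumes "norm w < 1"
  shows "peak w \<in> hinf" "hinf_norm (peak w) \<le> 1 / 5"
  using hinfI[OF peak_hol_disk[OF assms] norm_peak_le[OF assms]] by auto

context disk_function_space
begin

text \<open>If the condition fails along \<open>\<zeta>\<close>, the images of the test functions for
  \<open>w n = \<phi> (\<zeta> n)\<close> have a subsequence that converges in the Bloch norm. Their derivatives tend to
  \<open>0\<close> pointwise, so the limit \<open>l\<close> has derivative \<open>0\<close>; but at \<open>\<zeta> n\<close> the weighted derivative of
  the \<open>n\<close>-th image is at least \<open>|w n| \<epsilon> / 10\<close>, and this does not tend to \<open>0\<close>.\<close>

lemma vanishes_of_compact_commutator_id:
  assumes \<phi>: "\<phi> \<in> self_maps"
    and comp: "compact_operator X nX bloch bloch_norm (commutator \<phi> (on_disk (\<lambda>z. z)))"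
  shows "vanishes_when_near_circle \<phi> (\<lambda>z. norm (hyp_deriv \<phi> z) * norm (\<phi> z - z))"
proof (rule ccontr)
  let ?g = "on_disk (\<lambda>z. z)"
  let ?T = "commutator \<phi> ?g"
  assume "\<not> ?thesis"
  then obtain \<epsilon> where \<epsilon>: "\<epsilon> > 0" and
    far: "\<And>r. 0 < r \<Longrightarrow> r < 1 \<Longrightarrow>
      \<exists>z. norm z < 1 \<and> norm (\<phi> z) > r \<and> norm (hyp_deriv \<phi> z) * norm (\<phi> z - z) \<ge> \<epsilon>"
    unfolding vanishes_when_near_circle_def by (force simp: not_less)
  have gd: "?g \<in> hol_disk" by (intro hol_disk_on_disk holomorphic_intros)
  have "\<exists>z. norm z < 1 \<and> norm (\<phi> z) > 1 - 1 / real (n + 2) \<and> norm (hyp_deriv \<phi> z) * norm (\<phi> z - z) \<ge> \<epsilon>" for n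
    by (rule far) (auto simp: field_simps)
  then obtain \<zeta> where \<zeta>: "\<And>n. norm (\<zeta> n) < 1" "\<And>n. norm (\<phi> (\<zeta> n)) > 1 - 1 / real (n + 2)"
      "\<And>n. norm (hyp_deriv \<phi> (\<zeta> n)) * norm (\<phi> (\<zeta> n) - \<zeta> n) \<ge> \<epsilon>"
    by metis
  define w where "w n = \<phi> (\<zeta> n)" for n
  define a where "a n = 1 - (norm (w n))\<^sup>2" for n
  have w1: "norm (w n) < 1" for n using self_map_lt_1[OF \<phi> \<zeta>(1)] by (simp add: w_def)
  have w_lim: "(\<lambda>n. norm (w n)) \<longlonglongrightarrow> 1"
  proof (rule tendsto_sandwich)
    show "(\<lambda>n. 1 - 1 / real (n + 2)) \<longlonglongrightarrow> 1"
      using tendsto_diff[OF tendsto_const LIMSEQ_ignore_initial_segment[OF lim_1_over_n, of 2], of "1::real"]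
      by simp
    show "\<forall>\<^sub>F n in sequentially. 1 - 1 / real (n + 2) \<le> norm (w n)"
      using \<zeta>(2) by (intro always_eventually allI less_imp_le) (simp add: w_def)
    show "\<forall>\<^sub>F n in sequentially. norm (w n) \<le> 1"
      using w1 by (intro always_eventually allI less_imp_le)
  qed simp
  have a_lim: "a \<longlonglongrightarrow> 0"
    unfolding a_def[abs_def] using tendsto_diff[OF tendsto_const tendsto_power[OF w_lim, of 2], of 1] by simp
  define f where "f n = peak (w n)" for n
  have fd: "f n \<in> hol_disk" for n
    unfolding f_def by (rule peak_hol_disk[OF w1])
  have fX: "f n \<in> X \<and> nX (f n) \<le> 1" for n
    unfolding f_def by (rule small_hinf_in_ball[OF peak_hinf[OF w1]])
  have Tb: "?T h \<in> bloch" if "h \<in> X" for h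
    using comp that by (auto simp: compact_operator_def)
  let ?S = "norm_topology bloch bloch_norm closure_of (?T ` {f \<in> X. nX f \<le> 1})"
  have "range (\<lambda>n. ?T (f n)) \<subseteq> ?T ` {f \<in> X. nX f \<le> 1}"
    using fX by blast
  also have "\<dots> \<subseteq> ?S"
    using Tb by (intro subset_closure_of_bloch) blast
  finally have in_S: "range (\<lambda>n. ?T (f n)) \<subseteq> ?S" .
  have "compactin (norm_topology bloch bloch_norm) ?S"
    using comp by (simp add: compact_operator_def)
  from compactin_bloch_subseq[OF this in_S] obtain l r where l: "l \<in> bloch" and r: "strict_mono (r :: nat \<Rightarrow> nat)"
    and lim: "(\<lambda>n. bloch_norm (\<lambda>z. ?T (f (r n)) z - l z)) \<longlonglongrightarrow> 0"
    by blast
  have dist_ge: "(1 - (norm z)\<^sup>2) * norm (deriv (?T (f n)) z - deriv l z) \<le> bloch_norm (\<lambda>z. ?T (f n) z - l z)"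
    if "norm z < 1" for n z
    using bloch_norm_diff_ge[OF Tb l that] fX by blast
  have dl: "deriv l z = 0" if z: "norm z < 1" for z
  proof -
    have \<phi>z: "norm (\<phi> z) < 1" by (rule self_map_lt_1[OF \<phi> z])
    have "(\<lambda>n. deriv (f n) (\<phi> z)) \<longlonglongrightarrow> 0"
    proof (rule Lim_null_comparison)
      show "(\<lambda>n. a n / 10 / (1 - norm (\<phi> z))\<^sup>2) \<longlonglongrightarrow> 0"
        using a_lim by (intro tendsto_divide_zero) auto
      have "norm (deriv (f n) (\<phi> z)) \<le> a n / 10 / (1 - norm (\<phi> z))\<^sup>2" for n
        unfolding f_def a_def by (rule norm_deriv_peak_le[OF w1 \<phi>z])
      then show "\<forall>\<^sub>F n in sequentially. norm (deriv (f n) (\<phi> z)) \<le> a n / 10 / (1 - norm (\<phi> z))\<^sup>2"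
        by (intro always_eventually allI)
    qed
    then have "(\<lambda>n. deriv (f n) (\<phi> z) * deriv \<phi> z * (?g (\<phi> z) - ?g z)) \<longlonglongrightarrow> 0 * deriv \<phi> z * (?g (\<phi> z) - ?g z)"
      by (intro tendsto_intros)
    then have "(\<lambda>n. deriv (?T (f n)) z) \<longlonglongrightarrow> 0"
      unfolding deriv_commutator[OF \<phi> fd gd z] by simp
    then have "(\<lambda>n. deriv (?T (f (r n))) z) \<longlonglongrightarrow> 0"
      using LIMSEQ_subseq_LIMSEQ[OF _ r] by (fastforce simp: o_def)
    then have "(\<lambda>n. (1 - (norm z)\<^sup>2) * norm (deriv (?T (f (r n))) z - deriv l z))
        \<longlonglongrightarrow> (1 - (norm z)\<^sup>2) * norm (0 - deriv l z)"
      by (intro tendsto_intros)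
    then have "(1 - (norm z)\<^sup>2) * norm (0 - deriv l z) \<le> 0"
      by (rule LIMSEQ_le[OF _ lim]) (use dist_ge[OF z] in blast)
    then show ?thesis
      using one_minus_norm_sq_pos[OF z] by (simp add: mult_le_0_iff)
  qed
  have lower: "norm (w n) / 10 * \<epsilon> \<le> bloch_norm (\<lambda>z. ?T (f n) z - l z)" for n
  proof -
    have "(1 - (norm (w n))\<^sup>2) * norm (deriv (f n) (w n)) = norm (w n) / 10"
      unfolding f_def by (rule weighted_deriv_peak[OF w1])
    moreover have "?g (w n) - ?g (\<zeta> n) = \<phi> (\<zeta> n) - \<zeta> n"
      using w1[of n] \<zeta>(1)[of n] by (simp add: on_disk_def w_def)
    ultimately have "(1 - (norm (\<zeta> n))\<^sup>2) * norm (deriv (?T (f n)) (\<zeta> n)) =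
        norm (w n) / 10 * (norm (hyp_deriv \<phi> (\<zeta> n)) * norm (\<phi> (\<zeta> n) - \<zeta> n))"
      unfolding weighted_deriv_commutator[OF \<phi> fd gd \<zeta>(1)] w_def by simp
    then show ?thesis
      using dist_ge[OF \<zeta>(1), of n n] mult_left_mono[OF \<zeta>(3)[of n], of "norm (w n) / 10"]
      by (simp add: dl[OF \<zeta>(1)])
  qed
  have "(\<lambda>n. norm (w (r n)) / 10 * \<epsilon>) \<longlonglongrightarrow> 1 / 10 * \<epsilon>"
    using LIMSEQ_subseq_LIMSEQ[OF w_lim r] by (intro tendsto_intros) (simp_all add: o_def)
  then have "1 / 10 * \<epsilon> \<le> 0"
    by (rule LIMSEQ_le[OF _ lim]) (use lower in blast)
  then show False using \<epsilon> by simp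
qed

lemma compact_commutator_iff:
  assumes \<phi>: "\<phi> \<in> self_maps"
  shows "(\<forall>g\<in>disk_algebra. compact_operator X nX bloch bloch_norm (commutator \<phi> g)) \<longleftrightarrow>
    vanishes_when_near_circle \<phi> (\<lambda>z. norm (hyp_deriv \<phi> z) * norm (\<phi> z - z))"
proof
  have "on_disk (\<lambda>z. z) \<in> hinf"
    by (rule hinfI(1)[where B = 1], intro hol_disk_on_disk holomorphic_intros) (simp add: on_disk_def)
  then have "on_disk (\<lambda>z. z) \<in> disk_algebra"
    by (auto simp: disk_algebra_def on_disk_def intro!: exI[of _ "\<lambda>z. z"])
  then show "vanishes_when_near_circle \<phi> (\<lambda>z. norm (hyp_deriv \<phi> z) * norm (\<phi> z - z))"
    if "\<forall>g\<in>disk_algebra. compact_operator X nX bloch bloch_norm (commutator \<phi> g)"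
    using vanishes_of_compact_commutator_id[OF \<phi>] that by blast
  show "\<forall>g\<in>disk_algebra. compact_operator X nX bloch bloch_norm (commutator \<phi> g)"
    if "vanishes_when_near_circle \<phi> (\<lambda>z. norm (hyp_deriv \<phi> z) * norm (\<phi> z - z))"
    using compact_commutator[OF \<phi>] vanishes_for_disk_algebra[OF \<phi> _ that]
    by (auto simp: disk_algebra_def)
qed

end

theorem theorem3p7:
  fixes \<phi> :: "complex \<Rightarrow> complex"
    and X :: "(complex \<Rightarrow> complex) set"
    and normX :: "(complex \<Rightarrow> complex) \<Rightarrow> real"
  assumes "\<phi> \<in> self_maps"
    and "(X, normX) \<in> {(hinf, hinf_norm), (bloch, bloch_norm)}"
  shows "(\<forall>g\<in>disk_algebra. compact_operator X normX bloch bloch_norm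
            (\<lambda>f z. comp_op \<phi> (int_op g f) z - int_op g (comp_op \<phi> f) z)) \<longleftrightarrow>
         vanishes_when_near_circle \<phi> (\<lambda>z. norm (hyp_deriv \<phi> z) * norm (\<phi> z - z))"
proof -
  have "disk_function_space X normX"
    using assms(2) disk_function_space_hinf disk_function_space_bloch by auto
  then show ?thesis
    using disk_function_space.compact_commutator_iff[OF _ assms(1)]
    unfolding commutator_def[abs_def] by blast
qed

end
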